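(* Let $M^n_{a,b}(\xi)$ be a regular manifold of quasi-constant curvature, with metric $g$ and Levi-Civita connection $\nabla$. If $\alpha$ is a symmetric covariant tensor field of second order (type $(0,2)$) on $M$ which is parallel, i.e. $\nabla\alpha=0$, then $\alpha$ is a constant multiple of the metric tensor $g$.
   Context: Let $M$ be a smooth manifold of dimension $n>2$, $g$ a Riemannian metric on $M$, $\xi$ a unit vector field on $M$, and $\eta$ the $1$-form dual to $\xi$ with respect to $g$, i.e. $\eta(X)=g(X,\xi)$. The triple $(M,g,\xi)$ is called a manifold of quasi-constant curvature with generator $\xi$, denoted $M^n_{a,b}(\xi)$, if there are smooth functions $a,b\in C^\infty(M)$ such that for all vector fields $X,Y,Z$ the curvature tensor of $g$ satisfies $$R(X,Y)Z=a[g(Y,Z)X-g(X,Z)Y]+b[g(Y,Z)\eta(X)-g(X,Z)\eta(Y)]\xi+b\,\eta(Z)[\eta(Y)X-\eta(X)Y].$$ $M^n_{a,b}(\xi)$ is called regular if $a+b\neq 0$.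
   Formalization: The manifold M is assumed to be connected; on a disconnected M the claim fails, since a parallel symmetric tensor may be a different constant multiple of g on each component. *)

theory Defs
  imports "HOL-Analysis.Analysis"
begin

section \<open>Smooth maps between Euclidean spaces\<close>

text \<open>Meaningful for open \<open>S\<close>.\<close>

primrec Ck_on :: "nat \<Rightarrow> ('v::euclidean_space \<Rightarrow> 'w::real_normed_vector) \<Rightarrow> 'v set \<Rightarrow> bool" where
  "Ck_on 0 f S \<longleftrightarrow> continuous_on S f"
| "Ck_on (Suc k) f S \<longleftrightarrow>
     (\<forall>x\<in>S. f differentiable (at x)) \<and>
     (\<forall>v. Ck_on k (\<lambda>x. frechet_derivative f (at x) v) S)"

definition smooth_on :: "('v::euclidean_space \<Rightarrow> 'w::real_normed_vector) \<Rightarrow> 'v set \<Rightarrow> bool" where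
  "smooth_on f S \<longleftrightarrow> (\<forall>k. Ck_on k f S)"


section \<open>Smooth manifolds\<close>

text \<open>
  The manifold is a whole type \<open>'a\<close>, with the topology of its type class; the index type
  \<open>'n\<close> of the charts gives the dimension \<open>CARD('n)\<close>.  A smooth structure is given by an
  atlas, which need not be maximal: smooth functions, and hence everything defined from them
  below, are the same for an atlas and for the maximal atlas containing it.
  The predicate also contains the usual convention that a manifold is connected.
\<close>

type_synonym ('a, 'n) atlas = "('a set \<times> ('a \<Rightarrow> real ^ 'n)) set"

definition is_chart :: "'a::topological_space set \<Rightarrow> ('a \<Rightarrow> real ^ 'n) \<Rightarrow> bool" where
  "is_chart U \<phi> \<longleftrightarrow>
     open U \<and> open (\<phi> ` U) \<and> inj_on \<phi> U \<and> homeomorphism U (\<phi> ` U) \<phi> (inv_into U \<phi>)"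

definition smooth_manifold ::
    "('a::{t2_space,second_countable_topology}, 'n::finite) atlas \<Rightarrow> bool" where
  "smooth_manifold \<A> \<longleftrightarrow>
     connected (UNIV :: 'a set) \<and>
     (\<forall>(U, \<phi>)\<in>\<A>. is_chart U \<phi>) \<and>
     (\<Union>(U, \<phi>)\<in>\<A>. U) = UNIV \<and>
     (\<forall>(U, \<phi>)\<in>\<A>. \<forall>(V, \<psi>)\<in>\<A>. smooth_on (\<psi> \<circ> inv_into U \<phi>) (\<phi> ` (U \<inter> V)))"

definition smooth_fun :: "('a, 'n::finite) atlas \<Rightarrow> ('a \<Rightarrow> real) \<Rightarrow> bool" where
  "smooth_fun \<A> f \<longleftrightarrow> (\<forall>(U, \<phi>)\<in>\<A>. smooth_on (f \<circ> inv_into U \<phi>) (\<phi> ` U))"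


section \<open>Tangent vectors, vector fields and tensor fields\<close>

text \<open>
  Tangent vectors at \<open>p\<close> are the derivations at \<open>p\<close> of the algebra of smooth functions.  They
  are set to 0 on non-smooth functions, so that they are determined by their values on
  smooth functions and equality of tangent vectors is equality of HOL functions.
\<close>

type_synonym 'a tangent = "('a \<Rightarrow> real) \<Rightarrow> real"
type_synonym 'a field = "'a \<Rightarrow> 'a tangent"
type_synonym 'a tensor2 = "'a \<Rightarrow> 'a tangent \<Rightarrow> 'a tangent \<Rightarrow> real"

definition tangent_space :: "('a, 'n::finite) atlas \<Rightarrow> 'a \<Rightarrow> 'a tangent set" where
  "tangent_space \<A> p = {v.
     (\<forall>f h c d. smooth_fun \<A> f \<longrightarrow> smooth_fun \<A> h \<longrightarrow>
        v (\<lambda>q. c * f q + d * h q) = c * v f + d * v h) \<and>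
     (\<forall>f h. smooth_fun \<A> f \<longrightarrow> smooth_fun \<A> h \<longrightarrow>
        v (\<lambda>q. f q * h q) = f p * v h + h p * v f) \<and>
     (\<forall>f. \<not> smooth_fun \<A> f \<longrightarrow> v f = 0)}"

definition vector_field :: "('a, 'n::finite) atlas \<Rightarrow> 'a field \<Rightarrow> bool" where
  "vector_field \<A> X \<longleftrightarrow>
     (\<forall>p. X p \<in> tangent_space \<A> p) \<and>
     (\<forall>f. smooth_fun \<A> f \<longrightarrow> smooth_fun \<A> (\<lambda>p. X p f))"

definition lie_bracket :: "'a field \<Rightarrow> 'a field \<Rightarrow> 'a field" where
  "lie_bracket X Y = (\<lambda>p f. X p (\<lambda>q. Y q f) - Y p (\<lambda>q. X q f))"

text \<open>
  A tensor field of type (0,2) is a family of bilinear forms on the tangent spaces, depending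
  smoothly on the point; its values outside the tangent spaces are irrelevant.
\<close>

definition tensor_field2 :: "('a, 'n::finite) atlas \<Rightarrow> 'a tensor2 \<Rightarrow> bool" where
  "tensor_field2 \<A> \<alpha> \<longleftrightarrow>
     (\<forall>p. \<forall>u\<in>tangent_space \<A> p. \<forall>v\<in>tangent_space \<A> p. \<forall>w\<in>tangent_space \<A> p. \<forall>c d.
        \<alpha> p (\<lambda>f. c * u f + d * v f) w = c * \<alpha> p u w + d * \<alpha> p v w \<and>
        \<alpha> p w (\<lambda>f. c * u f + d * v f) = c * \<alpha> p w u + d * \<alpha> p w v) \<and>
     (\<forall>X Y. vector_field \<A> X \<longrightarrow> vector_field \<A> Y \<longrightarrow>
        smooth_fun \<A> (\<lambda>p. \<alpha> p (X p) (Y p)))"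

definition symmetric2 :: "('a, 'n::finite) atlas \<Rightarrow> 'a tensor2 \<Rightarrow> bool" where
  "symmetric2 \<A> \<alpha> \<longleftrightarrow>
     (\<forall>p. \<forall>u\<in>tangent_space \<A> p. \<forall>v\<in>tangent_space \<A> p. \<alpha> p u v = \<alpha> p v u)"

definition riemannian_metric :: "('a, 'n::finite) atlas \<Rightarrow> 'a tensor2 \<Rightarrow> bool" where
  "riemannian_metric \<A> g \<longleftrightarrow>
     tensor_field2 \<A> g \<and> symmetric2 \<A> g \<and>
     (\<forall>p. \<forall>v\<in>tangent_space \<A> p. v \<noteq> (\<lambda>f. 0) \<longrightarrow> g p v v > 0)"


section \<open>Connections and curvature\<close>

definition affine_connection ::
    "('a, 'n::finite) atlas \<Rightarrow> ('a field \<Rightarrow> 'a field \<Rightarrow> 'a field) \<Rightarrow> bool" where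
  "affine_connection \<A> D \<longleftrightarrow>
     (\<forall>X Y. vector_field \<A> X \<longrightarrow> vector_field \<A> Y \<longrightarrow> vector_field \<A> (D X Y)) \<and>
     (\<forall>X Y Z. vector_field \<A> X \<longrightarrow> vector_field \<A> Y \<longrightarrow> vector_field \<A> Z \<longrightarrow>
        D (\<lambda>p f. X p f + Y p f) Z = (\<lambda>p f. D X Z p f + D Y Z p f) \<and>
        D X (\<lambda>p f. Y p f + Z p f) = (\<lambda>p f. D X Y p f + D X Z p f)) \<and>
     (\<forall>h X Y. smooth_fun \<A> h \<longrightarrow> vector_field \<A> X \<longrightarrow> vector_field \<A> Y \<longrightarrow>
        D (\<lambda>p f. h p * X p f) Y = (\<lambda>p f. h p * D X Y p f) \<and>
        D X (\<lambda>p f. h p * Y p f) = (\<lambda>p f. X p h * Y p f + h p * D X Y p f))"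

text \<open>The function \<open>(\<nabla>\<^sub>X \<alpha>)(Y, Z)\<close>:\<close>

definition cov_deriv2 ::
    "('a field \<Rightarrow> 'a field \<Rightarrow> 'a field) \<Rightarrow> 'a tensor2 \<Rightarrow>
     'a field \<Rightarrow> 'a field \<Rightarrow> 'a field \<Rightarrow> 'a \<Rightarrow> real" where
  "cov_deriv2 D \<alpha> X Y Z p =
     X p (\<lambda>q. \<alpha> q (Y q) (Z q)) - \<alpha> p (D X Y p) (Z p) - \<alpha> p (Y p) (D X Z p)"

definition parallel2 ::
    "('a, 'n::finite) atlas \<Rightarrow> ('a field \<Rightarrow> 'a field \<Rightarrow> 'a field) \<Rightarrow> 'a tensor2 \<Rightarrow> bool" where
  "parallel2 \<A> D \<alpha> \<longleftrightarrow>
     (\<forall>X Y Z. vector_field \<A> X \<longrightarrow> vector_field \<A> Y \<longrightarrow> vector_field \<A> Z \<longrightarrow>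
        (\<forall>p. cov_deriv2 D \<alpha> X Y Z p = 0))"

text \<open>
  By the fundamental theorem of Riemannian geometry a metric \<open>g\<close> has exactly one Levi-Civita
  connection, up to the irrelevant values of \<open>D\<close> on arguments that are not vector fields.
\<close>

definition levi_civita ::
    "('a, 'n::finite) atlas \<Rightarrow> 'a tensor2 \<Rightarrow> ('a field \<Rightarrow> 'a field \<Rightarrow> 'a field) \<Rightarrow> bool" where
  "levi_civita \<A> g D \<longleftrightarrow>
     affine_connection \<A> D \<and>
     (\<forall>X Y. vector_field \<A> X \<longrightarrow> vector_field \<A> Y \<longrightarrow>
        (\<lambda>p f. D X Y p f - D Y X p f) = lie_bracket X Y) \<and>
     parallel2 \<A> D g"

definition curvature ::
    "('a field \<Rightarrow> 'a field \<Rightarrow> 'a field) \<Rightarrow> 'a field \<Rightarrow> 'a field \<Rightarrow> 'a field \<Rightarrow> 'a field" where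
  "curvature D X Y Z =
     (\<lambda>p f. D X (D Y Z) p f - D Y (D X Z) p f - D (lie_bracket X Y) Z p f)"


section \<open>Manifolds of quasi-constant curvature\<close>

definition unit_vector_field :: "('a, 'n::finite) atlas \<Rightarrow> 'a tensor2 \<Rightarrow> 'a field \<Rightarrow> bool" where
  "unit_vector_field \<A> g \<xi> \<longleftrightarrow> vector_field \<A> \<xi> \<and> (\<forall>p. g p (\<xi> p) (\<xi> p) = 1)"

definition dual_form :: "'a tensor2 \<Rightarrow> 'a field \<Rightarrow> 'a \<Rightarrow> 'a tangent \<Rightarrow> real" where
  "dual_form g \<xi> p v = g p v (\<xi> p)"

text \<open>Here \<open>D\<close> is meant to be the Levi-Civita connection of \<open>g\<close>.\<close>

definition quasi_constant_curvature ::
    "('a::{t2_space,second_countable_topology}, 'n::finite) atlas \<Rightarrow> 'a tensor2 \<Rightarrow>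
     ('a field \<Rightarrow> 'a field \<Rightarrow> 'a field) \<Rightarrow> 'a field \<Rightarrow> ('a \<Rightarrow> real) \<Rightarrow> ('a \<Rightarrow> real) \<Rightarrow> bool" where
  "quasi_constant_curvature \<A> g D \<xi> a b \<longleftrightarrow>
     smooth_manifold \<A> \<and> CARD('n) > 2 \<and> riemannian_metric \<A> g \<and> levi_civita \<A> g D \<and>
     unit_vector_field \<A> g \<xi> \<and> smooth_fun \<A> a \<and> smooth_fun \<A> b \<and>
     (\<forall>X Y Z. vector_field \<A> X \<longrightarrow> vector_field \<A> Y \<longrightarrow> vector_field \<A> Z \<longrightarrow>
        curvature D X Y Z =
          (\<lambda>p f. let \<eta> = dual_form g \<xi> p in
             a p * (g p (Y p) (Z p) * X p f - g p (X p) (Z p) * Y p f)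
           + b p * (g p (Y p) (Z p) * \<eta> (X p) - g p (X p) (Z p) * \<eta> (Y p)) * \<xi> p f
           + b p * \<eta> (Z p) * (\<eta> (Y p) * X p f - \<eta> (X p) * Y p f)))"

definition regular_qcc :: "('a \<Rightarrow> real) \<Rightarrow> ('a \<Rightarrow> real) \<Rightarrow> bool" where
  "regular_qcc a b \<longleftrightarrow> (\<forall>p. a p + b p \<noteq> 0)"

end

theory Submission
  imports Defs "HOL-Real_Asymp.Real_Asymp"
begin

text \<open>
  A parallel tensor \<open>\<alpha>\<close> is annihilated by the curvature operators, so
  \<open>\<alpha>(R(X, Y)Z, W) + \<alpha>(Z, R(X, Y)W) = 0\<close>.  For \<open>Y = Z = W = \<xi>\<close> the form of the curvature and
  \<open>a + b \<noteq> 0\<close> give \<open>\<alpha>(X, \<xi>) = \<alpha>(\<xi>, \<xi>) \<eta>(X)\<close>, and then \<open>Y = Z = \<xi>\<close> gives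
  \<open>\<alpha>(X, W) = \<alpha>(\<xi>, \<xi>) g(X, W)\<close>.  The factor \<open>\<alpha>(\<xi>, \<xi>)\<close> is constant, since
  \<open>X(\<alpha>(\<xi>, \<xi>)) = 2 \<alpha>(\<nabla>\<^sub>X \<xi>, \<xi>) = \<alpha>(\<xi>, \<xi>) X(g(\<xi>, \<xi>)) = 0\<close>.  To pass from vector fields to
  tangent vectors, which are derivations here, one needs that every derivation at a point is the
  value of a vector field; this follows from Hadamard's lemma and bump functions.
\<close>

section \<open>Calculus of smooth maps\<close>

text \<open>A derivative at a point depends on the values in a neighbourhood. Agreement on
  \<open>S\<close> passes to the derivatives because the open set \<open>S\<close> is a
  neighbourhood of each of its points.\<close>

lemma Ck_on_cong:
  assumes "open S" "\<And>x. x \<in> S \<Longrightarrow> f x = g x" "Ck_on k f S"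
  shows "Ck_on k g S"
  using assms(2,3)
proof (induction k arbitrary: f g)
  case 0
  then show ?case by (metis Ck_on.simps(1) continuous_on_cong)
next
  case (Suc k)
  have D: "(g has_derivative frechet_derivative f (at x)) (at x)" if "x \<in> S" for x
  proof -
    have "(f has_derivative frechet_derivative f (at x)) (at x)"
      using Suc.prems(2) that frechet_derivative_works by auto
    then show ?thesis
      using \<open>open S\<close> that Suc.prems(1) by (rule has_derivative_transform_within_open)
  qed
  have "Ck_on k (\<lambda>x. frechet_derivative g (at x) v) S" for v
  proof (rule Suc.IH)
    show "Ck_on k (\<lambda>x. frechet_derivative f (at x) v) S" using Suc.prems(2) by simp
    show "frechet_derivative f (at x) v = frechet_derivative g (at x) v" if "x \<in> S" for x
      using frechet_derivative_at[OF D[OF that]] by (rule fun_cong)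
  qed
  moreover have "g differentiable at x" if "x \<in> S" for x
    using D[OF that] by (rule differentiableI)
  ultimately show ?case by simp
qed

text \<open>\<open>frechet_derivative\<close> is defined by choice. Since derivatives are unique, an
  explicit \<open>f'\<close> may stand in for it; the inductions for sums, products and compositions
  supply their derivatives in this form.\<close>

lemma Ck_on_SucI:
  assumes "open S" "\<And>x. x \<in> S \<Longrightarrow> (f has_derivative f' x) (at x)"
    "\<And>v. Ck_on k (\<lambda>x. f' x v) S"
  shows "Ck_on (Suc k) f S"
proof -
  have "Ck_on k (\<lambda>x. frechet_derivative f (at x) v) S" for v
  proof (rule Ck_on_cong[OF assms(1) _ assms(3)])
    show "f' x v = frechet_derivative f (at x) v" if "x \<in> S" for x
      using frechet_derivative_at[OF assms(2)[OF that]] by (rule fun_cong)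
  qed
  moreover have "f differentiable at x" if "x \<in> S" for x
    using assms(2)[OF that] by (rule differentiableI)
  ultimately show ?thesis by simp
qed

lemma Ck_on_has_derivative:
  "Ck_on (Suc k) f S \<Longrightarrow> x \<in> S \<Longrightarrow> (f has_derivative frechet_derivative f (at x)) (at x)"
  using frechet_derivative_works by auto

lemma Ck_on_Suc_D: "Ck_on (Suc k) f S \<Longrightarrow> Ck_on k f S"
proof (induction k arbitrary: f)
  case 0
  then show ?case
    by (auto intro!: continuous_at_imp_continuous_on differentiable_imp_continuous_within)
next
  case (Suc k)
  then show ?case by (metis Ck_on.simps(2))
qed

lemma Ck_on_le: "Ck_on k f S \<Longrightarrow> j \<le> k \<Longrightarrow> Ck_on j f S"
  by (induction k) (auto simp: le_Suc_eq dest: Ck_on_Suc_D simp del: Ck_on.simps)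

lemma Ck_on_subset: "Ck_on k f S \<Longrightarrow> T \<subseteq> S \<Longrightarrow> Ck_on k f T"
  by (induction k arbitrary: f) (auto intro: continuous_on_subset)

text \<open>\<open>frechet_derivative\<close> refers to a point and not to a set, so one and the
  same derivative serves on all neighbourhoods \<open>T\<close> and the induction passes to it. This
  makes it possible to recognise as smooth a function given by different formulas on different open
  sets.\<close>

lemma Ck_on_local:
  "(\<And>x. x \<in> S \<Longrightarrow> \<exists>T. open T \<and> x \<in> T \<and> Ck_on k f T) \<Longrightarrow> Ck_on k f S"
proof (induction k arbitrary: f)
  case 0
  then have "continuous (at x) f" if "x \<in> S" for x
    using that by (metis Ck_on.simps(1) continuous_on_eq_continuous_at)
  then show ?case by (simp add: continuous_at_imp_continuous_on)
next
  case (Suc k)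
  have "Ck_on k (\<lambda>x. frechet_derivative f (at x) v) S" for v
    by (rule Suc.IH) (use Suc.prems in fastforce)
  moreover have "f differentiable at x" if "x \<in> S" for x
    using Suc.prems[OF that] by auto
  ultimately show ?case by simp
qed

lemma Ck_on_const: "open S \<Longrightarrow> Ck_on k (\<lambda>x. c) S"
proof (induction k arbitrary: c)
  case (Suc k)
  show ?case
    by (rule Ck_on_SucI[OF Suc.prems has_derivative_const Suc.IH[OF Suc.prems]])
qed simp

lemma Ck_on_add:
  assumes "open S" "Ck_on k f S" "Ck_on k g S"
  shows "Ck_on k (\<lambda>x. f x + g x) S"
  using assms(2,3)
proof (induction k arbitrary: f g)
  case 0
  then show ?case by (simp add: continuous_on_add)
next
  case (Suc k)
  show ?case
    by (rule Ck_on_SucI[OF assms(1)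
          has_derivative_add[OF Ck_on_has_derivative[OF Suc.prems(1)] Ck_on_has_derivative[OF Suc.prems(2)]]])
       (use Suc.prems in \<open>auto intro: Suc.IH\<close>)
qed

lemma Ck_on_sum:
  assumes "open S" "\<And>i. i \<in> I \<Longrightarrow> Ck_on k (f i) S"
  shows "Ck_on k (\<lambda>x. \<Sum>i\<in>I. f i x) S"
  using assms(2)
  by (induction I rule: infinite_finite_induct) (auto intro: Ck_on_const Ck_on_add assms(1))

lemma (in bounded_linear) Ck_on:
  assumes "open S" "Ck_on k g S"
  shows "Ck_on k (\<lambda>x. f (g x)) S"
  using assms(2)
proof (induction k arbitrary: g)
  case 0
  then show ?case by (simp add: continuous_on)
next
  case (Suc k)
  show ?case
    by (rule Ck_on_SucI[OF assms(1) has_derivative[OF Ck_on_has_derivative[OF Suc.prems]]])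
       (use Suc.prems in \<open>auto intro: Suc.IH\<close>)
qed

lemma (in bounded_bilinear) Ck_on:
  assumes "open S" "Ck_on k f S" "Ck_on k g S"
  shows "Ck_on k (\<lambda>x. prod (f x) (g x)) S"
  using assms(2,3)
proof (induction k arbitrary: f g)
  case 0
  then show ?case by (simp add: continuous_on)
next
  case (Suc k)
  show ?case
    by (rule Ck_on_SucI[OF assms(1)
          FDERIV[OF Ck_on_has_derivative[OF Suc.prems(1)] Ck_on_has_derivative[OF Suc.prems(2)]]])
       (use Suc.prems in \<open>auto intro!: Ck_on_add assms(1) Suc.IH Suc.prems[THEN Ck_on_Suc_D]\<close>)
qed

lemma Ck_on_bounded_linear:
  assumes "open S" "bounded_linear f"
  shows "Ck_on k f S"
proof (cases k)
  case 0
  then show ?thesis using assms by (simp add: linear_continuous_on)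
next
  case (Suc j)
  show ?thesis unfolding Suc
    by (rule Ck_on_SucI[OF assms(1) bounded_linear_imp_has_derivative[OF assms(2)]])
       (rule Ck_on_const[OF assms(1)])
qed

text \<open>The chain rule evaluates the derivative of \<open>f\<close> in a direction that varies
  with \<open>x\<close>, whereas \<open>Ck_on\<close> controls fixed directions. Expanding this
  direction in the basis gives a sum of products, in which the induction hypothesis applies to a
  derivative of \<open>f\<close> composed with the same \<open>g\<close>.\<close>

lemma Ck_on_compose:
  fixes f :: "'v::euclidean_space \<Rightarrow> 'w::real_normed_vector" and g :: "'u::euclidean_space \<Rightarrow> 'v"
  assumes "open S" "open T" "g ` S \<subseteq> T" "Ck_on k f T" "Ck_on k g S"
  shows "Ck_on k (\<lambda>x. f (g x)) S"
  using assms(4,5)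
proof (induction k arbitrary: f)
  case 0
  then show ?case using assms(3) by (auto intro: continuous_on_compose2)
next
  case (Suc k)
  let ?f' = "\<lambda>x v. \<Sum>b\<in>Basis. (frechet_derivative g (at x) v \<bullet> b) *\<^sub>R frechet_derivative f (at (g x)) b"
  show ?case
  proof (rule Ck_on_SucI[OF assms(1), where f' = ?f'])
    fix x assume x: "x \<in> S"
    let ?F = "frechet_derivative f (at (g x))" and ?G = "frechet_derivative g (at x)"
    have F: "(f has_derivative ?F) (at (g x))"
      using assms(3) x by (intro Ck_on_has_derivative[OF Suc.prems(1)]) auto
    have "((f \<circ> g) has_derivative (?F \<circ> ?G)) (at x)"
      by (rule diff_chain_at[OF Ck_on_has_derivative[OF Suc.prems(2) x] F])
    moreover have "?F (?G v) = ?f' x v" for v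
    proof -
      interpret F: bounded_linear ?F using F by (rule has_derivative_bounded_linear)
      show ?thesis
        by (subst euclidean_representation[of "?G v", symmetric]) (simp add: F.sum F.scaleR)
    qed
    ultimately show "((\<lambda>x. f (g x)) has_derivative ?f' x) (at x)" by (simp add: o_def)
  next
    fix v
    show "Ck_on k (\<lambda>x. ?f' x v) S"
    proof (intro Ck_on_sum bounded_bilinear.Ck_on[OF bounded_bilinear_scaleR]
        bounded_linear.Ck_on[OF bounded_linear_inner_left] Suc.IH assms(1))
      show "Ck_on k (\<lambda>x. frechet_derivative f (at x) b) T" for b using Suc.prems by simp
      show "Ck_on k (\<lambda>x. frechet_derivative g (at x) v) S" using Suc.prems by simp
      show "Ck_on k g S" using Suc.prems(2) by (rule Ck_on_Suc_D)
    qed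
  qed
qed

section \<open>Closure properties for all orders of differentiability at once\<close>

lemma smooth_on_cong:
  "open S \<Longrightarrow> (\<And>x. x \<in> S \<Longrightarrow> f x = g x) \<Longrightarrow> smooth_on f S \<Longrightarrow> smooth_on g S"
  using Ck_on_cong unfolding smooth_on_def by blast

lemma smooth_on_subset: "smooth_on f S \<Longrightarrow> T \<subseteq> S \<Longrightarrow> smooth_on f T"
  using Ck_on_subset unfolding smooth_on_def by blast

lemma smooth_on_local:
  "(\<And>x. x \<in> S \<Longrightarrow> \<exists>T. open T \<and> x \<in> T \<and> smooth_on f T) \<Longrightarrow> smooth_on f S"
  unfolding smooth_on_def by (intro allI Ck_on_local) meson

lemma smooth_on_const: "open S \<Longrightarrow> smooth_on (\<lambda>x. c) S"
  by (simp add: smooth_on_def Ck_on_const)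

lemma smooth_on_add:
  "open S \<Longrightarrow> smooth_on f S \<Longrightarrow> smooth_on g S \<Longrightarrow> smooth_on (\<lambda>x. f x + g x) S"
  by (simp add: smooth_on_def Ck_on_add)

lemma smooth_on_mult:
  fixes f g :: "_ \<Rightarrow> real"
  shows "open S \<Longrightarrow> smooth_on f S \<Longrightarrow> smooth_on g S \<Longrightarrow> smooth_on (\<lambda>x. f x * g x) S"
  by (simp add: smooth_on_def bounded_bilinear.Ck_on[OF bounded_bilinear_mult])

lemma smooth_on_inner:
  "open S \<Longrightarrow> smooth_on f S \<Longrightarrow> smooth_on g S \<Longrightarrow> smooth_on (\<lambda>x. f x \<bullet> g x) S"
  by (simp add: smooth_on_def bounded_bilinear.Ck_on[OF bounded_bilinear_inner])

lemma smooth_on_id: "open S \<Longrightarrow> smooth_on (\<lambda>x. x) S"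
  by (simp add: smooth_on_def Ck_on_bounded_linear bounded_linear_ident)

lemma smooth_on_diff_const: "open S \<Longrightarrow> smooth_on (\<lambda>x. x - c) S"
  using smooth_on_add[OF _ smooth_on_id smooth_on_const[of _ "- c"]] by simp

lemma smooth_on_compose:
  "open S \<Longrightarrow> open T \<Longrightarrow> g ` S \<subseteq> T \<Longrightarrow> smooth_on f T \<Longrightarrow> smooth_on g S
    \<Longrightarrow> smooth_on (\<lambda>x. f (g x)) S"
  by (simp add: smooth_on_def Ck_on_compose)

lemma smooth_on_deriv:
  "smooth_on f S \<Longrightarrow> smooth_on (\<lambda>x. frechet_derivative f (at x) v) S"
  unfolding smooth_on_def by (metis Ck_on.simps(2))

lemma smooth_on_has_derivative:
  "smooth_on f S \<Longrightarrow> x \<in> S \<Longrightarrow> (f has_derivative frechet_derivative f (at x)) (at x)"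
  unfolding smooth_on_def by (blast intro: Ck_on_has_derivative)

lemma smooth_on_continuous_on: "smooth_on f S \<Longrightarrow> continuous_on S f"
  unfolding smooth_on_def by (metis Ck_on.simps(1))

section \<open>Bump functions and Hadamard's lemma\<close>

text \<open>For \<open>m = 0\<close> this is the classical flat function. The division by
  \<open>t ^ m\<close> makes the family closed under differentiation up to linear combinations, so
  that its smoothness is a single induction over the order with \<open>m\<close> arbitrary.\<close>

definition flat_exp :: "nat \<Rightarrow> real \<Rightarrow> real" where
  "flat_exp m t = (if t > 0 then exp (- (1 / t)) / t ^ m else 0)"

lemma flat_exp_has_derivative:
  "(flat_exp m has_real_derivative flat_exp (m + 2) t - real m * flat_exp (m + 1) t) (at t)"
proof -
  consider "t > 0" | "t < 0" | "t = 0" by linarith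
  then show ?thesis
  proof cases
    case 1
    have "((\<lambda>t. exp (- (1 / t)) / t ^ m) has_real_derivative
        flat_exp (m + 2) t - real m * flat_exp (m + 1) t) (at t)"
      using 1 unfolding flat_exp_def
      by (cases m; auto intro!: derivative_eq_intros simp: field_simps power2_eq_square)
         (rename_tac j, case_tac j; simp)
    then show ?thesis
      by (rule has_field_derivative_transform_within_open[where S = "{0<..}"])
         (use 1 in \<open>auto simp: flat_exp_def\<close>)
  next
    case 2
    have "((\<lambda>t. 0) has_real_derivative 0) (at t)" by simp
    then have "(flat_exp m has_real_derivative 0) (at t)"
      by (rule has_field_derivative_transform_within_open[where S = "{..<0}"])
         (use 2 in \<open>auto simp: flat_exp_def\<close>)
    then show ?thesis using 2 by (simp add: flat_exp_def)
  next
    case 3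
    \<comment> \<open>At the origin the difference quotient is \<open>flat_exp m t / t\<close>. It
      vanishes from the left, and from the right the exponential decay beats every power of
      \<open>t\<close>.\<close>
    have "((\<lambda>t::real. exp (- (1 / t)) / t ^ (m + 1)) \<longlongrightarrow> 0) (at_right 0)"
      by real_asymp
    then have "((\<lambda>t. flat_exp m t / t) \<longlongrightarrow> 0) (at_right 0)"
      by (rule Lim_transform_eventually)
         (auto simp: flat_exp_def eventually_at_filter field_simps)
    moreover have "((\<lambda>t. flat_exp m t / t) \<longlongrightarrow> 0) (at_left 0)"
      by (rule Lim_transform_eventually[OF tendsto_const])
         (auto simp: flat_exp_def eventually_at_filter)
    ultimately have "((\<lambda>t. flat_exp m t / t) \<longlongrightarrow> 0) (at 0)"
      by (simp add: filterlim_at_split)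
    then show ?thesis using 3
      by (simp add: has_field_derivative_iff) (simp add: flat_exp_def)
  qed
qed

lemma smooth_on_flat_exp: "smooth_on (flat_exp m) UNIV"
proof -
  have "Ck_on k (flat_exp m) UNIV" for k
  proof (induction k arbitrary: m)
    case 0
    show ?case
      using DERIV_isCont[OF flat_exp_has_derivative] by (simp add: continuous_on_eq_continuous_within)
  next
    case (Suc k)
    show ?case
    proof (rule Ck_on_SucI[OF open_UNIV
          flat_exp_has_derivative[THEN has_field_derivative_imp_has_derivative]])
      fix v :: real
      have "Ck_on k (\<lambda>x. v * flat_exp (m + 2) x + (- (v * real m)) * flat_exp (m + 1) x) UNIV"
        by (intro Ck_on_add bounded_linear.Ck_on[OF bounded_linear_mult_right] Suc.IH) auto
      then show "Ck_on k (\<lambda>x. (flat_exp (m + 2) x - real m * flat_exp (m + 1) x) * v) UNIV"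
        by (simp add: algebra_simps)
    qed
  qed
  then show ?thesis by (simp add: smooth_on_def)
qed

lemma smooth_bump:
  fixes x :: "'v::euclidean_space"
  assumes "r > 0"
  obtains \<beta> :: "'v \<Rightarrow> real"
  where "smooth_on \<beta> UNIV" "\<beta> x = 1" "\<And>y. y \<notin> cball x r \<Longrightarrow> \<beta> y = 0"
proof
  \<comment> \<open>The argument \<open>r\<^sup>2 - |y - x|\<^sup>2\<close> is positive exactly on
    the open ball; dividing by the value at the centre normalises the bump to 1 there. Squared
    distance is used because the norm itself is not smooth at the centre.\<close>
  let ?\<beta> = "\<lambda>y. inverse (flat_exp 0 (r\<^sup>2)) * flat_exp 0 (r\<^sup>2 + (-1) * ((y - x) \<bullet> (y - x)))"
  show "smooth_on ?\<beta> UNIV"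
    by (intro smooth_on_mult smooth_on_const smooth_on_compose[OF _ _ _ smooth_on_flat_exp]
        smooth_on_add smooth_on_inner smooth_on_diff_const) auto
  show "?\<beta> x = 1" using assms by (simp add: flat_exp_def)
  show "?\<beta> y = 0" if "y \<notin> cball x r" for y
  proof -
    have "r \<le> norm (y - x)" using that by (simp add: dist_norm norm_minus_commute)
    then have "r\<^sup>2 \<le> (norm (y - x))\<^sup>2" using assms by (intro power_mono) auto
    then show ?thesis by (simp add: flat_exp_def power2_norm_eq_inner)
  qed
qed

text \<open>The weight \<open>t ^ m\<close> makes the family closed under differentiation: each derivative of the
  integrand brings out one factor \<open>t\<close>.\<close>

definition radial_mean :: "'v \<Rightarrow> nat \<Rightarrow> ('v::euclidean_space \<Rightarrow> real) \<Rightarrow> 'v \<Rightarrow> real" where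
  "radial_mean x m f y = integral (cbox 0 1) (\<lambda>t. t ^ m * f (x + t *\<^sub>R (y - x)))"

lemma ball_radial:
  fixes x :: "'v::real_normed_vector"
  assumes "y \<in> ball x r" "t \<in> cbox 0 (1::real)"
  shows "x + t *\<^sub>R (y - x) \<in> ball x r"
proof -
  have "norm (t *\<^sub>R (y - x)) \<le> norm (y - x)"
    using assms(2) by (simp add: mult_left_le_one_le)
  then show ?thesis using assms(1) by (simp add: dist_norm norm_minus_commute)
qed

lemma continuous_on_radial:
  fixes x :: "'v::real_normed_vector"
  assumes "continuous_on (ball x r) f"
  shows "continuous_on (ball x r \<times> cbox 0 1) (\<lambda>(y, t). t ^ m * f (x + t *\<^sub>R (y - x)) :: real)"
proof -
  have "continuous_on (ball x r \<times> cbox 0 1) (\<lambda>p. f (x + snd p *\<^sub>R (fst p - x)))"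
    by (rule continuous_on_compose2[OF assms])
       (use ball_radial in \<open>fastforce intro!: continuous_intros\<close>)+
  then show ?thesis by (auto simp: case_prod_unfold intro!: continuous_intros)
qed

lemma continuous_on_radial1:
  fixes x :: "'v::real_normed_vector"
  assumes "continuous_on (ball x r) f" "y \<in> ball x r"
  shows "continuous_on (cbox 0 1) (\<lambda>t. t ^ m * f (x + t *\<^sub>R (y - x)) :: real)"
  by (intro continuous_intros continuous_on_compose2[OF assms(1)] image_subsetI
      ball_radial[OF assms(2)])

text \<open>Differentiation under the integral sign. The Leibniz rule asks for a derivative of the
  integrand that is jointly continuous as a map into bounded linear maps, hence the detour through
  \<open>Blinfun\<close>.\<close>

lemma radial_mean_has_derivative:
  fixes f :: "'v::euclidean_space \<Rightarrow> real"
  assumes f: "Ck_on (Suc 0) f (ball x r)" and y: "y \<in> ball x r"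
  shows "(radial_mean x m f has_derivative
    (\<lambda>v. radial_mean x (Suc m) (\<lambda>z. frechet_derivative f (at z) v) y)) (at y)"
proof -
  let ?F = "\<lambda>z t. Blinfun (\<lambda>v. t ^ Suc m * frechet_derivative f (at (x + t *\<^sub>R (z - x))) v)"
  have cf: "continuous_on (ball x r) f" using Ck_on_Suc_D[OF f] by simp
  have cd: "continuous_on (ball x r) (\<lambda>z. frechet_derivative f (at z) v)" for v using f by simp
  have F: "blinfun_apply (?F z t) = (\<lambda>v. t ^ Suc m * frechet_derivative f (at (x + t *\<^sub>R (z - x))) v)"
    if "z \<in> ball x r" "t \<in> cbox 0 1" for z t
    by (rule bounded_linear_Blinfun_apply[OF bounded_linear_const_mult[OF
          has_derivative_bounded_linear[OF Ck_on_has_derivative[OF f ball_radial[OF that]]]]])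
  have D: "((\<lambda>z. t ^ m * f (x + t *\<^sub>R (z - x))) has_derivative blinfun_apply (?F z t)) (at z within ball x r)"
    if z: "z \<in> ball x r" and t: "t \<in> cbox 0 1" for z t
  proof -
    let ?L = "frechet_derivative f (at (x + t *\<^sub>R (z - x)))"
    have f': "(f has_derivative ?L) (at (x + t *\<^sub>R (z - x)))"
      by (intro Ck_on_has_derivative[OF f] ball_radial z t)
    interpret L: bounded_linear ?L using f' by (rule has_derivative_bounded_linear)
    have "((\<lambda>z. x + t *\<^sub>R (z - x)) has_derivative (\<lambda>v. t *\<^sub>R v)) (at z)"
      by (auto intro!: derivative_eq_intros)
    from diff_chain_at[OF this f']
    have "((\<lambda>z. f (x + t *\<^sub>R (z - x))) has_derivative (\<lambda>v. t * ?L v)) (at z)"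
      by (simp add: o_def L.scaleR)
    then have "((\<lambda>z. t ^ m * f (x + t *\<^sub>R (z - x))) has_derivative (\<lambda>v. t ^ m * (t * ?L v))) (at z)"
      by (rule has_derivative_mult_right)
    then show ?thesis using F[OF z t]
      by (simp add: has_derivative_at_withinI ac_simps)
  qed
  \<comment> \<open>In finite dimension, continuity of a family of bounded linear maps may be
    checked on each basis vector, where it reduces to continuity of a partial derivative of
    \<open>f\<close>.\<close>
  have cF: "continuous_on (ball x r \<times> cbox 0 1) (\<lambda>(z, t). ?F z t)"
  proof (rule continuous_on_blinfun_componentwise)
    fix i :: 'v
    show "continuous_on (ball x r \<times> cbox 0 1) (\<lambda>p. blinfun_apply (case p of (z, t) \<Rightarrow> ?F z t) i)"
      using continuous_on_radial[OF cd[of i], of "Suc m"]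
    proof (rule continuous_on_eq)
      fix p assume p: "p \<in> ball x r \<times> cbox 0 (1::real)"
      show "(case p of (z, t) \<Rightarrow> t ^ Suc m * frechet_derivative f (at (x + t *\<^sub>R (z - x))) i) =
          blinfun_apply (case p of (z, t) \<Rightarrow> ?F z t) i"
        using F[of "fst p" "snd p"] p by (simp only: case_prod_unfold mem_Times_iff)
    qed
  qed
  have "((\<lambda>z. integral (cbox 0 1) (\<lambda>t. t ^ m * f (x + t *\<^sub>R (z - x)))) has_derivative
      integral (cbox 0 1) (?F y)) (at y within ball x r)"
    by (rule leibniz_rule[OF D _ cF y])
       (assumption, assumption, rule integrable_continuous, erule continuous_on_radial1[OF cf],
        rule convex_ball)
  moreover have "blinfun_apply (integral (cbox 0 1) (?F y)) v =
      radial_mean x (Suc m) (\<lambda>z. frechet_derivative f (at z) v) y" for v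
  proof -
    have "continuous_on (cbox 0 1) (\<lambda>t. case (y, t) of (z, t) \<Rightarrow> ?F z t)"
      by (rule continuous_on_compose2[OF cF]) (use y in \<open>auto intro!: continuous_intros\<close>)
    then have "continuous_on (cbox 0 1) (?F y)" by (simp only: prod.case)
    then have "blinfun_apply (integral (cbox 0 1) (?F y)) v = integral (cbox 0 1) (\<lambda>t. blinfun_apply (?F y t) v)"
      by (intro blinfun_apply_integral integrable_continuous)
    also have "\<dots> = radial_mean x (Suc m) (\<lambda>z. frechet_derivative f (at z) v) y"
      unfolding radial_mean_def by (intro integral_cong) (simp only: F[OF y])
    finally show ?thesis .
  qed
  then have "blinfun_apply (integral (cbox 0 1) (?F y)) =
      (\<lambda>v. radial_mean x (Suc m) (\<lambda>z. frechet_derivative f (at z) v) y)" by (rule ext)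
  \<comment> \<open>The derivative was obtained within the ball; as the ball is open, it is the full
    derivative at \<open>y\<close>.\<close>
  ultimately show ?thesis
    unfolding radial_mean_def[abs_def] using at_within_open[OF y open_ball] by (simp only:)
qed

lemma Ck_on_radial_mean:
  "Ck_on k f (ball x r) \<Longrightarrow> Ck_on k (radial_mean x m f) (ball x r)"
proof (induction k arbitrary: f m)
  case 0
  then have "continuous_on (ball x r) f" by simp
  then show ?case unfolding radial_mean_def[abs_def] Ck_on.simps(1)
    by (intro integral_continuous_on_param continuous_on_radial)
next
  case (Suc k)
  have "Ck_on (Suc 0) f (ball x r)"
    using Suc.prems by (rule Ck_on_le) simp
  show ?case
  proof (rule Ck_on_SucI[OF open_ball radial_mean_has_derivative[OF \<open>Ck_on (Suc 0) f (ball x r)\<close>]])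
    show "Ck_on k (\<lambda>y. radial_mean x (Suc m) (\<lambda>z. frechet_derivative f (at z) v) y) (ball x r)" for v
      by (rule Suc.IH) (use Suc.prems in simp)
  qed
qed

text \<open>Integrate the derivative of \<open>f\<close> along the segment from \<open>x\<close> to
  \<open>y\<close>, expand \<open>y - x\<close> in the basis and pull the coordinates out of the
  integral. The functions \<open>g b\<close> are the averages of the partial derivatives over the
  segment; at \<open>y = x\<close> the integrand is constant.\<close>

lemma hadamard:
  fixes f :: "'v::euclidean_space \<Rightarrow> real"
  assumes f: "smooth_on f (ball x r)"
  obtains g :: "'v \<Rightarrow> 'v \<Rightarrow> real"
  where "\<And>b. smooth_on (g b) (ball x r)"
    and "\<And>b. g b x = frechet_derivative f (at x) b"
    and "\<And>y. y \<in> ball x r \<Longrightarrow> f y = f x + (\<Sum>b\<in>Basis. ((y - x) \<bullet> b) * g b y)"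
proof
  let ?g = "\<lambda>b. radial_mean x 0 (\<lambda>z. frechet_derivative f (at z) b)"
  show "smooth_on (?g b) (ball x r)" for b
    using smooth_on_deriv[OF f] Ck_on_radial_mean unfolding smooth_on_def by blast
  show "?g b x = frechet_derivative f (at x) b" for b
    by (simp add: radial_mean_def)
  show "f y = f x + (\<Sum>b\<in>Basis. ((y - x) \<bullet> b) * ?g b y)" if y: "y \<in> ball x r" for y
  proof -
    let ?L = "\<lambda>t. frechet_derivative f (at (x + t *\<^sub>R (y - x)))"
    have D: "(f has_derivative ?L t) (at (x + t *\<^sub>R (y - x)))" if "t \<in> cbox 0 1" for t
      by (intro smooth_on_has_derivative[OF f] ball_radial y that)
    have L: "?L t (y - x) = (\<Sum>b\<in>Basis. ((y - x) \<bullet> b) * ?L t b)" if "t \<in> cbox 0 1" for t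
    proof -
      interpret L: bounded_linear "?L t" using D[OF that] by (rule has_derivative_bounded_linear)
      have "?L t (\<Sum>b\<in>Basis. ((y - x) \<bullet> b) *\<^sub>R b) = (\<Sum>b\<in>Basis. ((y - x) \<bullet> b) * ?L t b)"
        by (simp only: L.sum L.scaleR real_scaleR_def)
      then show ?thesis by (simp only: euclidean_representation)
    qed
    have "((\<lambda>t. ?L t (y - x)) has_integral (f (x + 1 *\<^sub>R (y - x)) - f (x + 0 *\<^sub>R (y - x)))) {0..1}"
    proof (rule fundamental_theorem_of_calculus)
      fix t :: real assume "t \<in> {0..1}"
      then have t: "t \<in> cbox 0 1" by simp
      interpret L: bounded_linear "?L t" using D[OF t] by (rule has_derivative_bounded_linear)
      have "((\<lambda>t. x + t *\<^sub>R (y - x)) has_derivative (\<lambda>s. s *\<^sub>R (y - x))) (at t)"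
        by (auto intro!: derivative_eq_intros)
      from diff_chain_at[OF this D[OF t]]
      show "((\<lambda>t. f (x + t *\<^sub>R (y - x))) has_vector_derivative ?L t (y - x)) (at t within {0..1})"
        by (simp add: has_vector_derivative_def o_def L.scaleR has_derivative_at_withinI)
    qed simp
    then have "f y - f x = integral (cbox 0 1) (\<lambda>t. ?L t (y - x))"
      by (simp add: integral_unique)
    also have "\<dots> = integral (cbox 0 1) (\<lambda>t. \<Sum>b\<in>Basis. ((y - x) \<bullet> b) * ?L t b)"
      by (intro integral_cong L)
    also have "\<dots> = (\<Sum>b\<in>Basis. integral (cbox 0 1) (\<lambda>t. ((y - x) \<bullet> b) * ?L t b))"
      by (intro integral_sum integrable_continuous continuous_on_mult_left)
         (use continuous_on_radial1[OF smooth_on_continuous_on[OF smooth_on_deriv[OF f]] y, of 0] in auto)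
    also have "\<dots> = (\<Sum>b\<in>Basis. ((y - x) \<bullet> b) * ?g b y)"
      by (simp add: radial_mean_def)
    finally show ?thesis by simp
  qed
qed

section \<open>Smooth functions and vector fields on manifolds\<close>

lemma chart_openI:
  assumes "is_chart U \<phi>" "open W" "W \<subseteq> U"
  shows "open (\<phi> ` W)"
proof -
  have "\<phi> ` W = \<phi> ` U \<inter> inv_into U \<phi> -` W"
    using assms unfolding is_chart_def by (force simp: inv_into_f_f)
  moreover have "open (\<phi> ` U \<inter> inv_into U \<phi> -` W)"
    using assms unfolding is_chart_def homeomorphism_def
    by (intro continuous_open_preimage) auto
  ultimately show ?thesis by simp
qed

lemma smooth_manifold_chart: "smooth_manifold \<A> \<Longrightarrow> (U, \<phi>) \<in> \<A> \<Longrightarrow> is_chart U \<phi>"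
  unfolding smooth_manifold_def by blast

lemma smooth_manifold_cover:
  assumes "smooth_manifold \<A>"
  obtains U \<phi> where "(U, \<phi>) \<in> \<A>" "p \<in> U"
proof -
  have "p \<in> (\<Union>(U, \<phi>)\<in>\<A>. U)" using assms unfolding smooth_manifold_def by blast
  then show ?thesis using that by blast
qed

section \<open>Extension by zero from a chart to the manifold\<close>

definition zero_ext :: "'a set \<Rightarrow> ('a \<Rightarrow> 'v) \<Rightarrow> ('v \<Rightarrow> real) \<Rightarrow> 'a \<Rightarrow> real" where
  "zero_ext U \<phi> h p = (if p \<in> U then h (\<phi> p) else 0)"

text \<open>Seen in another chart, the extension is \<open>h\<close> after a transition map near
  points of \<open>U\<close>. Near a point outside \<open>U\<close> it is 0, because the preimage of
  \<open>K\<close> in the manifold is closed and misses that point.\<close>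

lemma smooth_fun_zero_ext:
  fixes \<A> :: "('a::{t2_space,second_countable_topology}, 'n::finite) atlas"
  assumes M: "smooth_manifold \<A>" and U: "(U, \<phi>) \<in> \<A>"
    and h: "smooth_on h (\<phi> ` U)"
    and K: "compact K" "K \<subseteq> \<phi> ` U" "\<And>y. y \<in> \<phi> ` U \<Longrightarrow> y \<notin> K \<Longrightarrow> h y = 0"
  shows "smooth_fun \<A> (zero_ext U \<phi> h)"
  unfolding smooth_fun_def
proof clarify
  fix V \<psi> assume V: "(V, \<psi>) \<in> \<A>"
  note cU = smooth_manifold_chart[OF M U] and cV = smooth_manifold_chart[OF M V]
  show "smooth_on (zero_ext U \<phi> h \<circ> inv_into V \<psi>) (\<psi> ` V)"
  proof (rule smooth_on_local)
    fix y assume "y \<in> \<psi> ` V"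
    then obtain q where q: "q \<in> V" "y = \<psi> q" by auto
    show "\<exists>T. open T \<and> y \<in> T \<and> smooth_on (zero_ext U \<phi> h \<circ> inv_into V \<psi>) T"
    proof (cases "q \<in> U")
      case True
      let ?T = "\<psi> ` (V \<inter> U)"
      have T: "open ?T"
        using cU cV by (intro chart_openI[OF cV]) (auto simp: is_chart_def)
      have inv: "inv_into V \<psi> (\<psi> z) = z" if "z \<in> V" for z
        using cV that by (simp add: is_chart_def)
      have "smooth_on (\<lambda>x. h ((\<phi> \<circ> inv_into V \<psi>) x)) ?T"
      proof (rule smooth_on_compose[OF T _ _ h])
        show "open (\<phi> ` U)" using cU by (simp add: is_chart_def)
        show "(\<phi> \<circ> inv_into V \<psi>) ` ?T \<subseteq> \<phi> ` U" by (auto simp: inv)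
        show "smooth_on (\<phi> \<circ> inv_into V \<psi>) ?T"
          using M U V unfolding smooth_manifold_def by fast
      qed
      then have "smooth_on (zero_ext U \<phi> h \<circ> inv_into V \<psi>) ?T"
        by (rule smooth_on_cong[OF T, rotated]) (auto simp: inv zero_ext_def)
      then show ?thesis using T q True by blast
    next
      case False
      let ?T = "\<psi> ` (V - inv_into U \<phi> ` K)"
      have "compact (inv_into U \<phi> ` K)"
        using cU K(1,2) unfolding is_chart_def homeomorphism_def
        by (metis compact_continuous_image continuous_on_subset)
      \<comment> \<open>The Hausdorff property of the manifold enters here: the compact set is
        closed in the whole space, not merely in \<open>U\<close>.\<close>
      then have "closed (inv_into U \<phi> ` K)" by (rule compact_imp_closed)
      then have T: "open ?T"
        using cV by (intro chart_openI[OF cV]) (auto simp: is_chart_def)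
      have "inv_into U \<phi> ` K \<subseteq> U" using K(2) by (auto intro: inv_into_into)
      then have "y \<in> ?T" using q False by auto
      moreover have "smooth_on (zero_ext U \<phi> h \<circ> inv_into V \<psi>) ?T"
      proof (rule smooth_on_cong[OF T _ smooth_on_const[OF T, of 0]])
        fix x assume "x \<in> ?T"
        then obtain z where z: "z \<in> V" "x = \<psi> z" "z \<notin> inv_into U \<phi> ` K" by auto
        have "h (\<phi> z) = 0" if "z \<in> U"
        proof (rule K(3))
          have "inv_into U \<phi> (\<phi> z) = z" using cU that by (simp add: is_chart_def)
          then show "\<phi> z \<notin> K" using z(3) by (metis imageI)
        qed (use that in simp)
        moreover have "inv_into V \<psi> x = z" using cV z by (simp add: is_chart_def)
        ultimately show "0 = (zero_ext U \<phi> h \<circ> inv_into V \<psi>) x" by (simp add: zero_ext_def)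
      qed
      ultimately show ?thesis using T by blast
    qed
  qed
qed

section \<open>The algebra of smooth functions\<close>

lemma smooth_fun_chart: "smooth_fun \<A> f \<Longrightarrow> (U, \<phi>) \<in> \<A> \<Longrightarrow> smooth_on (f \<circ> inv_into U \<phi>) (\<phi> ` U)"
  unfolding smooth_fun_def by blast

lemma smooth_fun_const: "smooth_manifold \<A> \<Longrightarrow> smooth_fun \<A> (\<lambda>p. c)"
  by (auto simp: smooth_fun_def o_def intro!: smooth_on_const
      dest: smooth_manifold_chart simp: is_chart_def)

lemma smooth_fun_add:
  assumes "smooth_manifold \<A>" "smooth_fun \<A> f" "smooth_fun \<A> h"
  shows "smooth_fun \<A> (\<lambda>p. f p + h p)"
  unfolding smooth_fun_def
proof clarify
  fix U \<phi> assume U: "(U, \<phi>) \<in> \<A>"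
  have "open (\<phi> ` U)" using smooth_manifold_chart[OF assms(1) U] by (simp add: is_chart_def)
  then show "smooth_on ((\<lambda>p. f p + h p) \<circ> inv_into U \<phi>) (\<phi> ` U)"
    using smooth_on_add[OF _ smooth_fun_chart[OF assms(2) U] smooth_fun_chart[OF assms(3) U]]
    by (simp add: o_def)
qed

lemma smooth_fun_mult:
  assumes "smooth_manifold \<A>" "smooth_fun \<A> f" "smooth_fun \<A> h"
  shows "smooth_fun \<A> (\<lambda>p. f p * h p)"
  unfolding smooth_fun_def
proof clarify
  fix U \<phi> assume U: "(U, \<phi>) \<in> \<A>"
  have "open (\<phi> ` U)" using smooth_manifold_chart[OF assms(1) U] by (simp add: is_chart_def)
  then show "smooth_on ((\<lambda>p. f p * h p) \<circ> inv_into U \<phi>) (\<phi> ` U)"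
    using smooth_on_mult[OF _ smooth_fun_chart[OF assms(2) U] smooth_fun_chart[OF assms(3) U]]
    by (simp add: o_def)
qed

lemma smooth_fun_lincomb:
  "smooth_manifold \<A> \<Longrightarrow> smooth_fun \<A> f \<Longrightarrow> smooth_fun \<A> h \<Longrightarrow> smooth_fun \<A> (\<lambda>p. c * f p + d * h p)"
  by (intro smooth_fun_add smooth_fun_mult smooth_fun_const)

lemma smooth_fun_sum:
  assumes "smooth_manifold \<A>" "\<And>i. i \<in> I \<Longrightarrow> smooth_fun \<A> (f i)"
  shows "smooth_fun \<A> (\<lambda>p. \<Sum>i\<in>I. f i p)"
  using assms(2)
  by (induction I rule: infinite_finite_induct)
     (auto intro: smooth_fun_const smooth_fun_add assms(1))

section \<open>Rules for derivations at a point\<close>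

lemma tangent_lincomb:
  "v \<in> tangent_space \<A> p \<Longrightarrow> smooth_fun \<A> f \<Longrightarrow> smooth_fun \<A> h \<Longrightarrow>
    v (\<lambda>q. c * f q + d * h q) = c * v f + d * v h"
  unfolding tangent_space_def by blast

lemma tangent_mult:
  "v \<in> tangent_space \<A> p \<Longrightarrow> smooth_fun \<A> f \<Longrightarrow> smooth_fun \<A> h \<Longrightarrow>
    v (\<lambda>q. f q * h q) = f p * v h + h p * v f"
  unfolding tangent_space_def by blast

lemma tangent_not_smooth: "v \<in> tangent_space \<A> p \<Longrightarrow> \<not> smooth_fun \<A> f \<Longrightarrow> v f = 0"
  unfolding tangent_space_def by blast

lemma tangent_add:
  "v \<in> tangent_space \<A> p \<Longrightarrow> smooth_fun \<A> f \<Longrightarrow> smooth_fun \<A> h \<Longrightarrow> v (\<lambda>q. f q + h q) = v f + v h"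
  using tangent_lincomb[of v \<A> p f h 1 1] by simp

text \<open>The product rule for \<open>1 * 1\<close> gives \<open>v 1 = 2 * v 1\<close>, hence
  \<open>v 1 = 0\<close>; linearity extends this to every constant.\<close>

lemma tangent_const:
  assumes "smooth_manifold \<A>" "v \<in> tangent_space \<A> p"
  shows "v (\<lambda>q. c) = 0"
  using tangent_mult[OF assms(2) smooth_fun_const[OF assms(1), of 1] smooth_fun_const[OF assms(1), of 1]]
    tangent_lincomb[OF assms(2) smooth_fun_const[OF assms(1), of 1] smooth_fun_const[OF assms(1), of 1], of c 0]
  by simp

lemma tangent_sum:
  assumes "smooth_manifold \<A>" "v \<in> tangent_space \<A> p" "\<And>i. i \<in> I \<Longrightarrow> smooth_fun \<A> (f i)"
  shows "v (\<lambda>q. \<Sum>i\<in>I. f i q) = (\<Sum>i\<in>I. v (f i))"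
  using assms(3)
  by (induction I rule: infinite_finite_induct)
     (simp_all add: tangent_const[OF assms(1,2)] tangent_add[OF assms(2)] smooth_fun_sum[OF assms(1)])

section \<open>Coordinate vector fields with cut-off\<close>

text \<open>The derivative in the fixed coordinate direction \<open>w\<close>, damped by
  \<open>\<beta>\<close> and continued by 0 outside the chart. The value 0 on functions that are not
  smooth follows the convention of \<open>tangent_space\<close>.\<close>

definition coord_field ::
    "('a, 'n::finite) atlas \<Rightarrow> 'a set \<Rightarrow> ('a \<Rightarrow> real ^ 'n) \<Rightarrow> (real ^ 'n \<Rightarrow> real) \<Rightarrow> real ^ 'n \<Rightarrow> 'a field"
  where "coord_field \<A> U \<phi> \<beta> w p f =
    (if smooth_fun \<A> f
     then zero_ext U \<phi> (\<lambda>y. \<beta> y * frechet_derivative (f \<circ> inv_into U \<phi>) (at y) w) p else 0)"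

lemma vector_field_coord_field:
  fixes \<A> :: "('a::{t2_space,second_countable_topology}, 'n::finite) atlas"
  assumes M: "smooth_manifold \<A>" and U: "(U, \<phi>) \<in> \<A>"
    and \<beta>: "smooth_on \<beta> UNIV"
    and K: "compact K" "K \<subseteq> \<phi> ` U" "\<And>y. y \<notin> K \<Longrightarrow> \<beta> y = 0"
  shows "vector_field \<A> (coord_field \<A> U \<phi> \<beta> w)"
proof -
  have cU: "open (\<phi> ` U)" "\<And>p. p \<in> U \<Longrightarrow> inv_into U \<phi> (\<phi> p) = p"
    using smooth_manifold_chart[OF M U] by (simp_all add: is_chart_def)
  have D: "(f \<circ> inv_into U \<phi> has_derivative frechet_derivative (f \<circ> inv_into U \<phi>) (at (\<phi> p))) (at (\<phi> p))"
    if "smooth_fun \<A> f" "p \<in> U" for f p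
    using smooth_on_has_derivative[OF smooth_fun_chart[OF that(1) U]] that(2) by blast
  have "coord_field \<A> U \<phi> \<beta> w p \<in> tangent_space \<A> p" for p
    unfolding tangent_space_def
  proof (intro CollectI conjI allI impI)
    fix f h c d assume fh: "smooth_fun \<A> f" "smooth_fun \<A> h"
    have "frechet_derivative ((\<lambda>q. c * f q + d * h q) \<circ> inv_into U \<phi>) (at (\<phi> p)) =
        (\<lambda>v. c * frechet_derivative (f \<circ> inv_into U \<phi>) (at (\<phi> p)) v
           + d * frechet_derivative (h \<circ> inv_into U \<phi>) (at (\<phi> p)) v)" if "p \<in> U"
      using has_derivative_add[OF has_derivative_mult_right[OF D[OF fh(1) that], of c]
          has_derivative_mult_right[OF D[OF fh(2) that], of d]]
      by (intro frechet_derivative_at[symmetric]) (simp add: o_def)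
    then show "coord_field \<A> U \<phi> \<beta> w p (\<lambda>q. c * f q + d * h q) =
        c * coord_field \<A> U \<phi> \<beta> w p f + d * coord_field \<A> U \<phi> \<beta> w p h"
      using fh smooth_fun_lincomb[OF M fh, of c d]
      by (simp add: coord_field_def zero_ext_def algebra_simps)
  next
    fix f h assume fh: "smooth_fun \<A> f" "smooth_fun \<A> h"
    have "frechet_derivative ((\<lambda>q. f q * h q) \<circ> inv_into U \<phi>) (at (\<phi> p)) =
        (\<lambda>v. f p * frechet_derivative (h \<circ> inv_into U \<phi>) (at (\<phi> p)) v
           + frechet_derivative (f \<circ> inv_into U \<phi>) (at (\<phi> p)) v * h p)" if "p \<in> U"
      using has_derivative_mult[OF D[OF fh(1) that] D[OF fh(2) that]] cU(2)[OF that]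
      by (intro frechet_derivative_at[symmetric]) (simp add: o_def)
    then show "coord_field \<A> U \<phi> \<beta> w p (\<lambda>q. f q * h q) =
        f p * coord_field \<A> U \<phi> \<beta> w p h + h p * coord_field \<A> U \<phi> \<beta> w p f"
      using fh smooth_fun_mult[OF M fh]
      by (simp add: coord_field_def zero_ext_def algebra_simps)
  qed (simp add: coord_field_def)
  moreover have "smooth_fun \<A> (\<lambda>p. coord_field \<A> U \<phi> \<beta> w p f)" if f: "smooth_fun \<A> f" for f
  proof -
    have "smooth_fun \<A> (zero_ext U \<phi> (\<lambda>y. \<beta> y * frechet_derivative (f \<circ> inv_into U \<phi>) (at y) w))"
      by (rule smooth_fun_zero_ext[OF M U _ K(1,2)])
         (auto intro!: smooth_on_mult cU(1) smooth_on_subset[OF \<beta>] smooth_on_deriv smooth_fun_chart[OF f U]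
           simp: K(3))
    then show ?thesis using f by (simp add: coord_field_def)
  qed
  ultimately show ?thesis unfolding vector_field_def by blast
qed

text \<open>The bump lives on the ball of radius \<open>r / 2\<close>, strictly inside the ball of
  radius \<open>r\<close>. A function that is smooth only on the larger ball can thus be multiplied
  by \<open>\<beta>\<close> and extended by zero.\<close>

lemma chart_bump:
  fixes \<A> :: "('a::{t2_space,second_countable_topology}, 'n::finite) atlas"
  assumes M: "smooth_manifold \<A>"
  obtains U \<phi> \<beta> r where "(U, \<phi>) \<in> \<A>" "p \<in> U" "r > 0" "cball (\<phi> p) r \<subseteq> \<phi> ` U"
    "smooth_on \<beta> UNIV" "\<beta> (\<phi> p) = (1::real)" "\<And>y. y \<notin> cball (\<phi> p) (r / 2) \<Longrightarrow> \<beta> y = 0"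
proof -
  obtain U \<phi> where U: "(U, \<phi>) \<in> \<A>" "p \<in> U" using smooth_manifold_cover[OF M] .
  have "open (\<phi> ` U)" using smooth_manifold_chart[OF M U(1)] by (simp add: is_chart_def)
  then obtain r where r: "r > 0" "cball (\<phi> p) r \<subseteq> \<phi> ` U"
    using U(2) open_contains_cball by (metis imageI)
  obtain \<beta> :: "real ^ 'n \<Rightarrow> real" where "smooth_on \<beta> UNIV" "\<beta> (\<phi> p) = 1"
    "\<And>y. y \<notin> cball (\<phi> p) (r / 2) \<Longrightarrow> \<beta> y = 0"
    using smooth_bump[of "r / 2" "\<phi> p"] r(1) by (metis half_gt_zero)
  then show ?thesis using that U r by blast
qed

text \<open>Hadamard's lemma shows that a derivation at \<open>p\<close> is determined by its values
  on the cut-off coordinate functions. The cut-off coordinate field whose direction has these values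
  as components therefore agrees with \<open>u\<close> at \<open>p\<close>.\<close>

lemma tangent_extend:
  fixes \<A> :: "('a::{t2_space,second_countable_topology}, 'n::finite) atlas"
  assumes M: "smooth_manifold \<A>" and u: "u \<in> tangent_space \<A> p"
  obtains X where "vector_field \<A> X" "X p = u"
proof -
  obtain U \<phi> \<beta> r where U: "(U, \<phi>) \<in> \<A>" "p \<in> U" and r: "r > 0" "cball (\<phi> p) r \<subseteq> \<phi> ` U"
    and \<beta>: "smooth_on \<beta> UNIV" "\<beta> (\<phi> p) = (1::real)" "\<And>y. y \<notin> cball (\<phi> p) (r / 2) \<Longrightarrow> \<beta> y = 0"
    using chart_bump[OF M, of p] by metis
  let ?K = "cball (\<phi> p) (r / 2)"
  have cU: "open (\<phi> ` U)" "\<And>p. p \<in> U \<Longrightarrow> inv_into U \<phi> (\<phi> p) = p"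
    using smooth_manifold_chart[OF M U(1)] by (simp_all add: is_chart_def)
  have KB: "?K \<subseteq> ball (\<phi> p) r" using r(1) by auto
  then have K: "compact ?K" "?K \<subseteq> \<phi> ` U"
    using r(2) ball_subset_cball[of "\<phi> p" r] by (simp, blast)
  have sm: "smooth_fun \<A> (zero_ext U \<phi> (\<lambda>y. \<beta> y * h y))" if h: "smooth_on h (ball (\<phi> p) r)" for h
  proof (rule smooth_fun_zero_ext[OF M U(1) _ K])
    show "smooth_on (\<lambda>y. \<beta> y * h y) (\<phi> ` U)"
    proof (rule smooth_on_local)
      fix y
      show "\<exists>T. open T \<and> y \<in> T \<and> smooth_on (\<lambda>y. \<beta> y * h y) T"
      proof (cases "y \<in> ball (\<phi> p) r")
        case True
        have "smooth_on (\<lambda>y. \<beta> y * h y) (ball (\<phi> p) r)"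
          by (intro smooth_on_mult h smooth_on_subset[OF \<beta>(1)]) auto
        then show ?thesis using True by blast
      next
        case False
        have "smooth_on (\<lambda>y. \<beta> y * h y) (- ?K)"
          by (rule smooth_on_cong[OF _ _ smooth_on_const[of _ 0]]) (auto simp: \<beta>(3))
        then show ?thesis using False KB by (intro exI[of _ "- ?K"]) auto
      qed
    qed
  qed (simp add: \<beta>(3))
  let ?x = "\<lambda>b. zero_ext U \<phi> (\<lambda>y. \<beta> y * ((y - \<phi> p) \<bullet> b))"
  \<comment> \<open>The components of \<open>u\<close> in the chart: its values on the coordinate
    functions centred at \<open>p\<close>.\<close>
  define w where "w = (\<Sum>b\<in>Basis. u (?x b) *\<^sub>R b)"
  let ?X = "coord_field \<A> U \<phi> \<beta> w"
  have "?X p f = u f" for f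
  proof (cases "smooth_fun \<A> f")
    case True
    let ?f = "f \<circ> inv_into U \<phi>"
    have sf: "smooth_on ?f (ball (\<phi> p) r)"
      by (rule smooth_on_subset[OF smooth_fun_chart[OF True U(1)]])
         (use r(2) ball_subset_cball[of "\<phi> p" r] in blast)
    obtain g where g: "\<And>b. smooth_on (g b) (ball (\<phi> p) r)"
      "\<And>b. g b (\<phi> p) = frechet_derivative ?f (at (\<phi> p)) b"
      "\<And>y. y \<in> ball (\<phi> p) r \<Longrightarrow> ?f y = ?f (\<phi> p) + (\<Sum>b\<in>Basis. ((y - \<phi> p) \<bullet> b) * g b y)"
      using hadamard[OF sf] by blast
    let ?g = "\<lambda>b. zero_ext U \<phi> (\<lambda>y. \<beta> y * g b y)"
    let ?\<rho> = "zero_ext U \<phi> (\<lambda>y. \<beta> y * 1)"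
    let ?h = "\<lambda>q. 1 * f q + (- f p) * 1"
    have sx: "smooth_fun \<A> (?x b)" for b
      by (intro sm smooth_on_inner smooth_on_diff_const smooth_on_const open_ball)
    have sg: "smooth_fun \<A> (?g b)" for b by (rule sm[OF g(1)])
    have s\<rho>: "smooth_fun \<A> ?\<rho>" by (rule sm[OF smooth_on_const[OF open_ball]])
    have sh: "smooth_fun \<A> ?h" by (intro smooth_fun_lincomb[OF M True] smooth_fun_const[OF M])
    have at_p: "?\<rho> p = 1" "?x b p = 0" "?g b p = frechet_derivative ?f (at (\<phi> p)) b" for b
      using U(2) \<beta>(2) g(2) by (simp_all add: zero_ext_def)
    txt \<open>The factor \<open>\<rho>\<^sup>2\<close> turns Hadamard's local expansion into an identity of smooth functions on
      the whole manifold, so that locality of derivations is not needed.\<close>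
    have eq: "(\<lambda>q. (?\<rho> q * ?\<rho> q) * ?h q) = (\<lambda>q. \<Sum>b\<in>Basis. ?x b q * ?g b q)"
    proof
      fix q
      show "(?\<rho> q * ?\<rho> q) * ?h q = (\<Sum>b\<in>Basis. ?x b q * ?g b q)"
      proof (cases "q \<in> U \<and> \<phi> q \<in> ball (\<phi> p) r")
        case True
        then have "f q - f p = (\<Sum>b\<in>Basis. ((\<phi> q - \<phi> p) \<bullet> b) * g b (\<phi> q))"
          using g(3)[of "\<phi> q"] cU(2) U(2) by simp
        then show ?thesis using True
          by (simp add: zero_ext_def sum_distrib_left) (simp add: sum_distrib_left ac_simps)
      next
        case False
        then have "q \<notin> U \<or> \<beta> (\<phi> q) = 0" using KB \<beta>(3) by blast
        then show ?thesis by (auto simp: zero_ext_def)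
      qed
    qed
    \<comment> \<open>\<open>?h\<close> vanishes at \<open>p\<close> and \<open>?\<rho>\<close> is 1
      there, so the product rule leaves the value of \<open>u\<close> on \<open>?h\<close>, which is
      \<open>u f\<close> since constants are killed.\<close>
    have "u (\<lambda>q. (?\<rho> q * ?\<rho> q) * ?h q) = u f"
      using tangent_mult[OF u smooth_fun_mult[OF M s\<rho> s\<rho>] sh]
        tangent_lincomb[OF u True smooth_fun_const[OF M, of 1], of 1 "- f p"] tangent_const[OF M u]
      by (simp add: at_p(1)[simplified])
    \<comment> \<open>Each \<open>?x b\<close> vanishes at \<open>p\<close>, so only the terms in
      which \<open>u\<close> acts on \<open>?x b\<close> survive.\<close>
    moreover have "u (\<lambda>q. \<Sum>b\<in>Basis. ?x b q * ?g b q) =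
        (\<Sum>b\<in>Basis. frechet_derivative ?f (at (\<phi> p)) b * u (?x b))"
      by (subst tangent_sum[OF M u smooth_fun_mult[OF M sx sg]])
         (simp add: tangent_mult[OF u sx sg] at_p)
    ultimately have "u f = (\<Sum>b\<in>Basis. frechet_derivative ?f (at (\<phi> p)) b * u (?x b))"
      using eq by simp
    moreover have "?X p f = frechet_derivative ?f (at (\<phi> p)) w"
      using True U(2) \<beta>(2) by (simp add: coord_field_def zero_ext_def)
    moreover have "frechet_derivative ?f (at (\<phi> p)) w =
        (\<Sum>b\<in>Basis. frechet_derivative ?f (at (\<phi> p)) b * u (?x b))"
    proof -
      interpret L: bounded_linear "frechet_derivative ?f (at (\<phi> p))"
        by (rule has_derivative_bounded_linear[OF smooth_on_has_derivative[OF sf]]) (use r(1) in simp)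
      show ?thesis unfolding w_def by (simp add: L.sum L.scaleR mult.commute)
    qed
    ultimately show ?thesis by simp
  next
    case False
    then show ?thesis using tangent_not_smooth[OF u] by (simp add: coord_field_def)
  qed
  then have "?X p = u" by blast
  moreover have "vector_field \<A> ?X"
    by (rule vector_field_coord_field[OF M U(1) \<beta>(1) K \<beta>(3)])
  ultimately show ?thesis using that by blast
qed

text \<open>Cut-off coordinate fields show that the derivative of \<open>f\<close> is zero in every
  chart, so \<open>f\<close> is constant on coordinate balls. Connectedness, which is part of
  \<open>smooth_manifold\<close>, turns local constancy into a global one.\<close>

lemma vector_fields_kill_imp_const:
  fixes \<A> :: "('a::{t2_space,second_countable_topology}, 'n::finite) atlas"
  assumes M: "smooth_manifold \<A>" and f: "smooth_fun \<A> f"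
    and kill: "\<And>X p. vector_field \<A> X \<Longrightarrow> X p f = 0"
  obtains c where "\<And>p. f p = c"
proof -
  have D0: "(f \<circ> inv_into U \<phi> has_derivative (\<lambda>v. 0)) (at y)"
    if U: "(U, \<phi>) \<in> \<A>" and y: "y \<in> \<phi> ` U" for U \<phi> y
  proof -
    have "open (\<phi> ` U)" using smooth_manifold_chart[OF M U(1)] by (simp add: is_chart_def)
    then obtain r where r: "r > 0" "cball y r \<subseteq> \<phi> ` U" using y open_contains_cball by metis
    obtain \<beta> :: "real ^ 'n \<Rightarrow> real" where \<beta>: "smooth_on \<beta> UNIV" "\<beta> y = 1" "\<And>z. z \<notin> cball y r \<Longrightarrow> \<beta> z = 0"
      using smooth_bump[OF r(1)] by metis
    have "frechet_derivative (f \<circ> inv_into U \<phi>) (at y) w = 0" for w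
    proof -
      obtain p where p: "p \<in> U" "y = \<phi> p" using y by blast
      have "coord_field \<A> U \<phi> \<beta> w p f = 0"
        by (rule kill[OF vector_field_coord_field[OF M U \<beta>(1) compact_cball r(2) \<beta>(3)]])
      then show ?thesis using f p \<beta>(2) by (simp add: coord_field_def zero_ext_def)
    qed
    then have "frechet_derivative (f \<circ> inv_into U \<phi>) (at y) = (\<lambda>v. 0)" by blast
    then show ?thesis using smooth_on_has_derivative[OF smooth_fun_chart[OF f U] y] by simp
  qed
  have "eventually (\<lambda>q. f p = f q) (at p)" for p
  proof -
    obtain U \<phi> where U: "(U, \<phi>) \<in> \<A>" "p \<in> U" using smooth_manifold_cover[OF M] .
    have cU: "open U" "open (\<phi> ` U)" "continuous_on U \<phi>" "\<And>p. p \<in> U \<Longrightarrow> inv_into U \<phi> (\<phi> p) = p"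
      using smooth_manifold_chart[OF M U(1)] by (auto simp: is_chart_def homeomorphism_def)
    obtain r where r: "r > 0" "ball (\<phi> p) r \<subseteq> \<phi> ` U"
      using cU(2) U(2) open_contains_ball by (metis imageI)
    have "open (U \<inter> \<phi> -` ball (\<phi> p) r)"
      by (rule continuous_open_preimage[OF cU(3,1) open_ball])
    moreover have "f p = f q" if q: "q \<in> U \<inter> \<phi> -` ball (\<phi> p) r" for q
    proof -
      have "\<exists>c. \<forall>y\<in>ball (\<phi> p) r. (f \<circ> inv_into U \<phi>) y = c"
        by (rule has_derivative_zero_constant[OF convex_ball])
           (use D0[OF U(1)] r(2) in \<open>blast intro: has_derivative_at_withinI\<close>)
      then have "(f \<circ> inv_into U \<phi>) (\<phi> p) = (f \<circ> inv_into U \<phi>) (\<phi> q)"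
        using q r(1) by (metis IntD2 centre_in_ball vimageD)
      then show ?thesis using cU(4) U(2) q by simp
    qed
    ultimately show ?thesis
      using U(2) r(1) unfolding eventually_at_topological
      by (intro exI[of _ "U \<inter> \<phi> -` ball (\<phi> p) r"]) auto
  qed
  then have "f p = f q" for p q
    using M connected_local_const[of UNIV p q f] unfolding smooth_manifold_def by simp
  then show ?thesis using that by blast
qed

section \<open>Parallel tensors\<close>

lemma vector_field_tangent: "vector_field \<A> X \<Longrightarrow> X p \<in> tangent_space \<A> p"
  unfolding vector_field_def by blast

lemma vector_field_smooth: "vector_field \<A> X \<Longrightarrow> smooth_fun \<A> f \<Longrightarrow> smooth_fun \<A> (\<lambda>p. X p f)"
  unfolding vector_field_def by blast

lemma tangent_space_lincomb:
  assumes "u \<in> tangent_space \<A> p" "v \<in> tangent_space \<A> p"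
  shows "(\<lambda>f. c * u f + d * v f) \<in> tangent_space \<A> p"
  using assms unfolding tangent_space_def by (auto simp: algebra_simps)

text \<open>In the product rule for the commutator the mixed first-order terms are symmetric in
  \<open>X\<close> and \<open>Y\<close> and cancel.\<close>

lemma vector_field_lie_bracket:
  assumes M: "smooth_manifold \<A>" and X: "vector_field \<A> X" and Y: "vector_field \<A> Y"
  shows "vector_field \<A> (lie_bracket X Y)"
proof -
  note XT = vector_field_tangent[OF X] and YT = vector_field_tangent[OF Y]
  note sX = vector_field_smooth[OF X] and sY = vector_field_smooth[OF Y]
  have "lie_bracket X Y p \<in> tangent_space \<A> p" for p
    unfolding tangent_space_def
  proof (intro CollectI conjI allI impI)
    fix f h c d assume f: "smooth_fun \<A> f" and h: "smooth_fun \<A> h"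
    show "lie_bracket X Y p (\<lambda>q. c * f q + d * h q) = c * lie_bracket X Y p f + d * lie_bracket X Y p h"
      by (simp add: lie_bracket_def tangent_lincomb[OF XT] tangent_lincomb[OF YT] f h sX sY algebra_simps)
  next
    fix f h assume f: "smooth_fun \<A> f" and h: "smooth_fun \<A> h"
    show "lie_bracket X Y p (\<lambda>q. f q * h q) = f p * lie_bracket X Y p h + h p * lie_bracket X Y p f"
      by (simp add: lie_bracket_def tangent_mult[OF XT] tangent_mult[OF YT] tangent_add[OF XT]
          tangent_add[OF YT] smooth_fun_mult[OF M] f h sX sY algebra_simps)
  next
    \<comment> \<open>Here the inner functions are identically 0, hence smooth, and the outer
      derivations kill them as constants.\<close>
    fix f assume "\<not> smooth_fun \<A> f"
    then show "lie_bracket X Y p f = 0"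
      by (simp add: lie_bracket_def tangent_not_smooth[OF XT] tangent_not_smooth[OF YT]
          tangent_const[OF M XT] tangent_const[OF M YT])
  qed
  moreover have "smooth_fun \<A> (\<lambda>p. lie_bracket X Y p f)" if "smooth_fun \<A> f" for f
    using smooth_fun_lincomb[OF M sX[OF sY[OF that]] sY[OF sX[OF that]], of 1 "-1"]
    by (simp add: lie_bracket_def)
  ultimately show ?thesis unfolding vector_field_def by blast
qed

lemma tensor_field2_lincomb:
  assumes "tensor_field2 \<A> \<alpha>" "u \<in> tangent_space \<A> p" "v \<in> tangent_space \<A> p" "w \<in> tangent_space \<A> p"
  shows "\<alpha> p (\<lambda>f. c * u f + d * v f) w = c * \<alpha> p u w + d * \<alpha> p v w"
    and "\<alpha> p w (\<lambda>f. c * u f + d * v f) = c * \<alpha> p w u + d * \<alpha> p w v"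
  using assms unfolding tensor_field2_def by blast+

lemma tensor_field2_smooth:
  "tensor_field2 \<A> \<alpha> \<Longrightarrow> vector_field \<A> X \<Longrightarrow> vector_field \<A> Y \<Longrightarrow> smooth_fun \<A> (\<lambda>p. \<alpha> p (X p) (Y p))"
  unfolding tensor_field2_def by blast

lemma parallel2_deriv:
  assumes "parallel2 \<A> D \<alpha>" "vector_field \<A> X" "vector_field \<A> Y" "vector_field \<A> Z"
  shows "X p (\<lambda>q. \<alpha> q (Y q) (Z q)) = \<alpha> p (D X Y p) (Z p) + \<alpha> p (Y p) (D X Z p)"
proof -
  have "cov_deriv2 D \<alpha> X Y Z p = 0" using assms unfolding parallel2_def by blast
  then show ?thesis by (simp add: cov_deriv2_def)
qed

lemma affine_connection_field:
  "affine_connection \<A> D \<Longrightarrow> vector_field \<A> X \<Longrightarrow> vector_field \<A> Y \<Longrightarrow> vector_field \<A> (D X Y)"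
  unfolding affine_connection_def by blast

lemma tensor_field2_curvature:
  assumes M: "smooth_manifold \<A>" and D: "affine_connection \<A> D" and T: "tensor_field2 \<A> \<alpha>"
    and X: "vector_field \<A> X" and Y: "vector_field \<A> Y" and Z: "vector_field \<A> Z" and w: "w \<in> tangent_space \<A> p"
  shows "\<alpha> p (curvature D X Y Z p) w =
      \<alpha> p (D X (D Y Z) p) w - \<alpha> p (D Y (D X Z) p) w - \<alpha> p (D (lie_bracket X Y) Z p) w" (is ?L)
    and "\<alpha> p w (curvature D X Y Z p) =
      \<alpha> p w (D X (D Y Z) p) - \<alpha> p w (D Y (D X Z) p) - \<alpha> p w (D (lie_bracket X Y) Z p)" (is ?R)
proof -
  note conn = affine_connection_field[OF D]
  note t = vector_field_tangent[OF conn[OF X conn[OF Y Z]]] vector_field_tangent[OF conn[OF Y conn[OF X Z]]]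
    vector_field_tangent[OF conn[OF vector_field_lie_bracket[OF M X Y] Z]]
  \<comment> \<open>Bilinearity is stated for combinations of two vectors, so the three terms of the
    curvature are nested with coefficients 1 and -1.\<close>
  have eq: "curvature D X Y Z p = (\<lambda>f. 1 * (\<lambda>f. 1 * D X (D Y Z) p f + (-1) * D Y (D X Z) p f) f
      + (-1) * D (lie_bracket X Y) Z p f)"
    by (simp add: curvature_def)
  note d = tangent_space_lincomb[OF t(1,2)]
  show ?L unfolding eq
    by (simp only: tensor_field2_lincomb(1)[OF T d t(3) w] tensor_field2_lincomb(1)[OF T t(1,2) w])
       simp
  show ?R unfolding eq
    by (simp only: tensor_field2_lincomb(2)[OF T d t(3) w] tensor_field2_lincomb(2)[OF T t(1,2) w])
       simp
qed

text \<open>Differentiate the function \<open>\<alpha>(Z, W)\<close> twice. In the commutator of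
  \<open>X\<close> and \<open>Y\<close> the mixed terms, one derivative on each argument, cancel by
  symmetry; comparison with the derivative along the bracket leaves the curvature terms.\<close>

lemma parallel2_ricci_identity:
  assumes M: "smooth_manifold \<A>" and D: "affine_connection \<A> D"
    and T: "tensor_field2 \<A> \<alpha>" and P: "parallel2 \<A> D \<alpha>"
    and X: "vector_field \<A> X" and Y: "vector_field \<A> Y" and Z: "vector_field \<A> Z" and W: "vector_field \<A> W"
  shows "\<alpha> p (curvature D X Y Z p) (W p) + \<alpha> p (Z p) (curvature D X Y W p) = 0"
proof -
  note conn = affine_connection_field[OF D]
  note B = vector_field_lie_bracket[OF M X Y]
  have second: "U p (\<lambda>q. V q (\<lambda>q. \<alpha> q (Z q) (W q))) =
      \<alpha> p (D U (D V Z) p) (W p) + \<alpha> p (D V Z p) (D U W p)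
      + (\<alpha> p (D U Z p) (D V W p) + \<alpha> p (Z p) (D U (D V W) p))"
    if U: "vector_field \<A> U" and V: "vector_field \<A> V" for U V
  proof -
    have "U p (\<lambda>q. V q (\<lambda>q. \<alpha> q (Z q) (W q))) =
        U p (\<lambda>q. \<alpha> q (D V Z q) (W q) + \<alpha> q (Z q) (D V W q))"
      by (simp only: parallel2_deriv[OF P V Z W])
    also have "\<dots> = U p (\<lambda>q. \<alpha> q (D V Z q) (W q)) + U p (\<lambda>q. \<alpha> q (Z q) (D V W q))"
      by (intro tangent_add[OF vector_field_tangent[OF U]] tensor_field2_smooth[OF T] Z W conn V)
    finally show ?thesis
      by (simp only: parallel2_deriv[OF P U conn[OF V Z] W] parallel2_deriv[OF P U Z conn[OF V W]])
  qed
  have "lie_bracket X Y p (\<lambda>q. \<alpha> q (Z q) (W q)) =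
      X p (\<lambda>q. Y q (\<lambda>q. \<alpha> q (Z q) (W q))) - Y p (\<lambda>q. X q (\<lambda>q. \<alpha> q (Z q) (W q)))"
    by (simp add: lie_bracket_def)
  then show ?thesis
    unfolding tensor_field2_curvature(1)[OF M D T X Y Z vector_field_tangent[OF W]]
      tensor_field2_curvature(2)[OF M D T X Y W vector_field_tangent[OF Z]]
      parallel2_deriv[OF P B Z W] second[OF X Y] second[OF Y X]
    by linarith
qed

section \<open>Parallel tensors under quasi-constant curvature\<close>

lemma symmetric2_fields:
  "symmetric2 \<A> \<alpha> \<Longrightarrow> vector_field \<A> X \<Longrightarrow> vector_field \<A> Y \<Longrightarrow> \<alpha> p (X p) (Y p) = \<alpha> p (Y p) (X p)"
  unfolding symmetric2_def vector_field_def by blast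

lemma qccD:
  assumes "quasi_constant_curvature \<A> g D \<xi> a b"
  shows "smooth_manifold \<A>" "tensor_field2 \<A> g" "symmetric2 \<A> g" "affine_connection \<A> D"
    "parallel2 \<A> D g" "vector_field \<A> \<xi>" "g p (\<xi> p) (\<xi> p) = 1"
  using assms unfolding quasi_constant_curvature_def riemannian_metric_def levi_civita_def
    unit_vector_field_def by blast+

text \<open>As \<open>\<eta>(\<xi>) = 1\<close>, the two terms with
  \<open>\<eta>(X) \<eta>(V) \<xi>\<close> cancel and what remains is
  \<open>(a + b)(\<eta>(V) X - g(X, V) \<xi>)\<close>. This is where the factor \<open>a + b\<close>
  of the regularity condition appears.\<close>

lemma qcc_curvature_generator:
  assumes Q: "quasi_constant_curvature \<A> g D \<xi> a b"
    and X: "vector_field \<A> X" and V: "vector_field \<A> V"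
  shows "curvature D X \<xi> V p = (\<lambda>f. (a p + b p) * g p (V p) (\<xi> p) * X p f
      + (a p * - g p (X p) (V p) - b p * g p (X p) (V p)) * \<xi> p f)"
proof -
  note sym = symmetric2_fields[OF qccD(3)[OF Q] qccD(6)[OF Q]]
  have "curvature D X \<xi> V = (\<lambda>p f. let \<eta> = dual_form g \<xi> p in
           a p * (g p (\<xi> p) (V p) * X p f - g p (X p) (V p) * \<xi> p f)
         + b p * (g p (\<xi> p) (V p) * \<eta> (X p) - g p (X p) (V p) * \<eta> (\<xi> p)) * \<xi> p f
         + b p * \<eta> (V p) * (\<eta> (\<xi> p) * X p f - \<eta> (X p) * \<xi> p f))"
    using Q X qccD(6)[OF Q] V unfolding quasi_constant_curvature_def by blast
  then show ?thesis
    by (simp add: dual_form_def qccD(7)[OF Q] sym[OF V] algebra_simps)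
qed

text \<open>With the generator as second argument of the curvature, the whole Ricci identity carries
  the factor \<open>a + b\<close>, which regularity allows to be cancelled.\<close>

lemma qcc_ricci_identity:
  assumes Q: "quasi_constant_curvature \<A> g D \<xi> a b" and R: "regular_qcc a b"
    and T: "tensor_field2 \<A> \<alpha>" and P: "parallel2 \<A> D \<alpha>"
    and X: "vector_field \<A> X" and Z: "vector_field \<A> Z" and W: "vector_field \<A> W"
  shows "g p (Z p) (\<xi> p) * \<alpha> p (X p) (W p) - g p (X p) (Z p) * \<alpha> p (\<xi> p) (W p)
      + g p (W p) (\<xi> p) * \<alpha> p (Z p) (X p) - g p (X p) (W p) * \<alpha> p (Z p) (\<xi> p) = 0"
proof -
  note \<xi> = qccD(6)[OF Q]
  note lc = tensor_field2_lincomb[OF T vector_field_tangent[OF X] vector_field_tangent[OF \<xi>]]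
  have "\<alpha> p (curvature D X \<xi> Z p) (W p) + \<alpha> p (Z p) (curvature D X \<xi> W p) = 0"
    by (rule parallel2_ricci_identity[OF qccD(1,4)[OF Q] T P X \<xi> Z W])
  then have "(a p + b p) * (g p (Z p) (\<xi> p) * \<alpha> p (X p) (W p) - g p (X p) (Z p) * \<alpha> p (\<xi> p) (W p)
      + g p (W p) (\<xi> p) * \<alpha> p (Z p) (X p) - g p (X p) (W p) * \<alpha> p (Z p) (\<xi> p)) = 0"
    unfolding qcc_curvature_generator[OF Q X Z] qcc_curvature_generator[OF Q X W]
      lc[OF vector_field_tangent[OF W]] lc[OF vector_field_tangent[OF Z]]
    by (simp add: algebra_simps)
  moreover have "a p + b p \<noteq> 0" using R unfolding regular_qcc_def by blast
  ultimately show ?thesis by simp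
qed

lemma qcc_parallel_proportional:
  assumes Q: "quasi_constant_curvature \<A> g D \<xi> a b" and R: "regular_qcc a b"
    and T: "tensor_field2 \<A> \<alpha>" and S: "symmetric2 \<A> \<alpha>" and P: "parallel2 \<A> D \<alpha>"
    and X: "vector_field \<A> X" and W: "vector_field \<A> W"
  shows "\<alpha> p (X p) (W p) = \<alpha> p (\<xi> p) (\<xi> p) * g p (X p) (W p)"
proof -
  note \<xi> = qccD(6)[OF Q] and unit = qccD(7)[OF Q]
  note ricci = qcc_ricci_identity[OF Q R T P]
  \<comment> \<open>With \<open>Z = W = \<xi>\<close> the four terms pair up by symmetry of
    \<open>\<alpha>\<close>, and the identity is twice the claim.\<close>
  have generator: "\<alpha> p (\<xi> p) (V p) = g p (V p) (\<xi> p) * \<alpha> p (\<xi> p) (\<xi> p)" if V: "vector_field \<A> V" for V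
    using ricci[OF V \<xi> \<xi>, of p] symmetric2_fields[OF S V \<xi>, of p] by (simp add: unit)
  \<comment> \<open>With \<open>Z = \<xi>\<close> the two middle terms are both
    \<open>\<eta>(X) \<eta>(W) \<alpha>(\<xi>, \<xi>)\<close> up to opposite signs, and
    cancel.\<close>
  show ?thesis
    using ricci[OF X \<xi> W, of p] by (simp add: unit generator[OF X] generator[OF W])
qed

theorem theorem2p5:
  fixes \<A> :: "('a::{t2_space,second_countable_topology}, 'n::finite) atlas"
    and g \<alpha> :: "'a tensor2"
    and D :: "'a field \<Rightarrow> 'a field \<Rightarrow> 'a field"
    and \<xi> :: "'a field"
    and a b :: "'a \<Rightarrow> real"
  assumes "quasi_constant_curvature \<A> g D \<xi> a b"
    and "regular_qcc a b"
    and "tensor_field2 \<A> \<alpha>"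
    and "symmetric2 \<A> \<alpha>"
    and "parallel2 \<A> D \<alpha>"
  shows "\<exists>c::real. \<forall>p. \<forall>u\<in>tangent_space \<A> p. \<forall>v\<in>tangent_space \<A> p. \<alpha> p u v = c * g p u v"
proof -
  note Q = assms(1)
  note M = qccD(1)[OF Q] and \<xi> = qccD(6)[OF Q]
  note proportional = qcc_parallel_proportional[OF assms]
  let ?c = "\<lambda>p. \<alpha> p (\<xi> p) (\<xi> p)"
  have "X p ?c = 0" if X: "vector_field \<A> X" for X p
  proof -
    note DX = affine_connection_field[OF qccD(4)[OF Q] X \<xi>]
    have "0 = X p (\<lambda>q. g q (\<xi> q) (\<xi> q))"
      using tangent_const[OF M vector_field_tangent[OF X], of p 1] by (simp add: qccD(7)[OF Q])
    also have "\<dots> = g p (D X \<xi> p) (\<xi> p) + g p (\<xi> p) (D X \<xi> p)"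
      by (rule parallel2_deriv[OF qccD(5)[OF Q] X \<xi> \<xi>])
    \<comment> \<open>Multiplication by the factor turns the \<open>g\<close> terms into
      \<open>\<alpha>\<close> terms by proportionality; since \<open>\<alpha>\<close> is parallel,
      these add up to the derivative of the factor itself.\<close>
    finally have "0 = ?c p * (g p (D X \<xi> p) (\<xi> p) + g p (\<xi> p) (D X \<xi> p))" by simp
    also have "\<dots> = X p ?c"
      by (simp add: parallel2_deriv[OF assms(5) X \<xi> \<xi>] proportional[OF DX \<xi>] proportional[OF \<xi> DX] distrib_left)
    finally show ?thesis by simp
  qed
  then obtain c where c: "\<And>p. ?c p = c"
    using vector_fields_kill_imp_const[OF M tensor_field2_smooth[OF assms(3) \<xi> \<xi>]] by blast
  have "\<alpha> p u v = c * g p u v" if u: "u \<in> tangent_space \<A> p" and v: "v \<in> tangent_space \<A> p" for p u v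
  proof -
    obtain X Y where "vector_field \<A> X" "X p = u" "vector_field \<A> Y" "Y p = v"
      using tangent_extend[OF M u] tangent_extend[OF M v] by metis
    then show ?thesis using proportional[of X Y p] c[of p] by simp
  qed
  then show ?thesis by blast
qed

end
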